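(* Let $V=\mathbb R^n$ and let $W\subseteq\bigwedge^r V$ be a linear subspace. Then for $0\le c\le n-r$, $$\frac{\dim\left(W\wedge\bigwedge^c V\right)}{\binom{n}{r+c}}\ge\frac{\dim W}{\binom nr}.$$ Equality occurs only when $W=\{0\}$ or $W=\bigwedge^r V$.
   Context: Here $0\le r\le n$ and $c$ are integers, and $\bigwedge^r V$ denotes the $r$-th exterior power of $V$. For linear subspaces $U,W$ of the exterior algebra $\bigwedge V$, $U\wedge W=\operatorname{span}\{u\wedge w: u\in U,\ w\in W\}$.
   Formalization: The equality clause is stated only for c ≥ 1: for c = 0 one has W∧Λ^0V = W, so equality holds for every W (e.g. a line W in V = ℝ^2 with r = 1) and the clause as printed fails; the inequality itself covers all 0 ≤ c ≤ n − r. *)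

theory Defs
  imports "HOL-Analysis.Analysis" "HOL-Analysis.Finite_Function_Topology"
begin

text \<open>
  The exterior algebra of \<open>\<real>\<^sup>n\<close> in its standard coordinate model. An element is a finite linear
  combination of the basis elements \<open>e\<^sub>S = single S 1\<close>, where for \<open>S = {i\<^sub>1 < \<dots> < i\<^sub>k} \<subseteq> {..<n}\<close>
  the symbol \<open>e\<^sub>S\<close> stands for \<open>e\<^sub>i\<^sub>1 \<and> \<dots> \<and> e\<^sub>i\<^sub>k\<close>. The type does not depend on \<open>n\<close>; the vector
  space \<open>V = \<real>\<^sup>n\<close> is the span of the \<open>e\<^sub>{\<^sub>i\<^sub>}\<close> with \<open>i < n\<close>. Infinite index sets, where \<open>wedge_sign\<close> has no
  meaning, do not occur in any \<open>ext_power n r\<close>.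
\<close>

type_synonym ext = "(nat set, real) poly_mapping"

abbreviation ebasis :: "nat set \<Rightarrow> ext" where
  "ebasis S \<equiv> Poly_Mapping.single S 1"

text \<open>Sign of the permutation that sorts the concatenation of the increasing enumerations of the
  disjoint finite sets \<open>S\<close> and \<open>T\<close>: the parity of the number of its inversions.\<close>

definition wedge_sign :: "nat set \<Rightarrow> nat set \<Rightarrow> real" where
  "wedge_sign S T = (-1) ^ card {(i, j). i \<in> S \<and> j \<in> T \<and> j < i}"

definition wedge :: "ext \<Rightarrow> ext \<Rightarrow> ext" (infixr "\<and>\<^sub>e" 70) where
  "x \<and>\<^sub>e y = (\<Sum>S\<in>Poly_Mapping.keys x. \<Sum>T\<in>Poly_Mapping.keys y.
      if S \<inter> T = {}
      then Poly_Mapping.single (S \<union> T)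
             (wedge_sign S T * Poly_Mapping.lookup x S * Poly_Mapping.lookup y T)
      else 0)"

definition ext_vectors :: "nat \<Rightarrow> ext set" where
  "ext_vectors n = span ((\<lambda>i. ebasis {i}) ` {..<n})"

text \<open>The \<open>r\<close>-th exterior power of \<open>V\<close>: the span of all \<open>v\<^sub>1 \<and> \<dots> \<and> v\<^sub>r\<close> with \<open>v\<^sub>i \<in> V\<close>;
  the unit of the algebra is \<open>e\<^sub>{\<^sub>}\<close>, so that the zeroth power is the line of scalars.\<close>

definition ext_power :: "nat \<Rightarrow> nat \<Rightarrow> ext set" where
  "ext_power n r =
     span {foldr (\<and>\<^sub>e) vs (ebasis {}) | vs. length vs = r \<and> set vs \<subseteq> ext_vectors n}"

definition wedge_space :: "ext set \<Rightarrow> ext set \<Rightarrow> ext set" where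
  "wedge_space U W = span {u \<and>\<^sub>e w | u w. u \<in> U \<and> w \<in> W}"


text \<open>The remaining facts confirm that this is the exterior algebra: the product is bilinear,
  associative and unital, squares of vectors vanish, \<open>e\<^sub>S\<close> is the ordered product of the
  corresponding \<open>e\<^sub>i\<close>, and the \<open>e\<^sub>S\<close> with \<open>card S = r\<close> are a basis of the \<open>r\<close>-th power.\<close>

lemma lookup_scaleR_ext:
  "Poly_Mapping.lookup (a *\<^sub>R (x::ext)) S = a * Poly_Mapping.lookup x S"
proof -
  have "finite {i. a *\<^sub>R Poly_Mapping.lookup x i \<noteq> 0}"
    by (rule finite_subset[OF _ finite_keys[of x]]) (auto simp: in_keys_iff)
  then show ?thesis by (simp add: scaleR_poly_mapping_def Abs_poly_mapping_inverse)
qed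

lemma single_eq_scaleR: "Poly_Mapping.single S a = a *\<^sub>R ebasis S"
  by (rule poly_mapping_eqI) (simp add: lookup_scaleR_ext lookup_single when_def)

lemma ext_expansion: "(x::ext) = (\<Sum>S\<in>Poly_Mapping.keys x. Poly_Mapping.lookup x S *\<^sub>R ebasis S)"
  by (rule poly_mapping_eqI)
     (simp add: lookup_sum lookup_scaleR_ext lookup_single when_def if_distrib[of "\<lambda>t. _ * t"]
        in_keys_iff cong: if_cong)

lemma wedge_superset:
  assumes "finite A" "Poly_Mapping.keys x \<subseteq> A" "finite B" "Poly_Mapping.keys y \<subseteq> B"
  shows "x \<and>\<^sub>e y = (\<Sum>S\<in>A. \<Sum>T\<in>B. (if S \<inter> T = {} then
           (wedge_sign S T * Poly_Mapping.lookup x S * Poly_Mapping.lookup y T) *\<^sub>R ebasis (S \<union> T) else 0))"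
proof -
  have "x \<and>\<^sub>e y = (\<Sum>S\<in>Poly_Mapping.keys x. \<Sum>T\<in>B. (if S \<inter> T = {} then
           (wedge_sign S T * Poly_Mapping.lookup x S * Poly_Mapping.lookup y T) *\<^sub>R ebasis (S \<union> T) else 0))"
    unfolding wedge_def single_eq_scaleR[symmetric] using assms
    by (intro sum.cong[OF refl] sum.mono_neutral_left) (auto simp: in_keys_iff)
  also have "\<dots> = (\<Sum>S\<in>A. \<Sum>T\<in>B. (if S \<inter> T = {} then
           (wedge_sign S T * Poly_Mapping.lookup x S * Poly_Mapping.lookup y T) *\<^sub>R ebasis (S \<union> T) else 0))"
    using assms by (intro sum.mono_neutral_left) (auto simp: in_keys_iff intro!: sum.neutral)
  finally show ?thesis .
qed

lemma bilinear_wedge: "bilinear (\<and>\<^sub>e)"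
proof -
  have add_left: "(x + y) \<and>\<^sub>e z = x \<and>\<^sub>e z + y \<and>\<^sub>e z" for x y z
  proof -
    let ?A = "Poly_Mapping.keys x \<union> Poly_Mapping.keys y"
    have k: "Poly_Mapping.keys (x + y) \<subseteq> ?A" by (rule Poly_Mapping.keys_add)
    show ?thesis
      unfolding wedge_superset[OF _ k finite_keys order_refl, simplified]
        wedge_superset[of ?A x "Poly_Mapping.keys z" z, simplified]
        wedge_superset[of ?A y "Poly_Mapping.keys z" z, simplified]
        sum.distrib[symmetric]
      by (intro sum.cong refl) (auto simp: lookup_add distrib_left distrib_right scaleR_add_left)
  qed
  have add_right: "z \<and>\<^sub>e (x + y) = z \<and>\<^sub>e x + z \<and>\<^sub>e y" for x y z
  proof -
    let ?A = "Poly_Mapping.keys x \<union> Poly_Mapping.keys y"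
    have k: "Poly_Mapping.keys (x + y) \<subseteq> ?A" by (rule Poly_Mapping.keys_add)
    show ?thesis
      unfolding wedge_superset[OF finite_keys order_refl _ k, simplified]
        wedge_superset[of "Poly_Mapping.keys z" z ?A x, simplified]
        wedge_superset[of "Poly_Mapping.keys z" z ?A y, simplified]
        sum.distrib[symmetric]
      by (intro sum.cong refl) (auto simp: lookup_add distrib_left distrib_right scaleR_add_left)
  qed
  have kc: "Poly_Mapping.keys (a *\<^sub>R x) \<subseteq> Poly_Mapping.keys x" for a and x :: ext
    by (auto simp: in_keys_iff lookup_scaleR_ext)
  have sc_left: "(a *\<^sub>R x) \<and>\<^sub>e z = a *\<^sub>R (x \<and>\<^sub>e z)" for a x z
    unfolding wedge_superset[OF finite_keys kc finite_keys order_refl]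
    unfolding wedge_superset[OF finite_keys order_refl finite_keys order_refl] scaleR_sum_right
    by (intro sum.cong refl) (auto simp: lookup_scaleR_ext)
  have sc_right: "z \<and>\<^sub>e (a *\<^sub>R x) = a *\<^sub>R (z \<and>\<^sub>e x)" for a x z
    unfolding wedge_superset[OF finite_keys order_refl finite_keys kc]
    unfolding wedge_superset[OF finite_keys order_refl finite_keys order_refl] scaleR_sum_right
    by (intro sum.cong refl) (auto simp: lookup_scaleR_ext)
  show ?thesis
    unfolding bilinear_def by (auto intro!: linearI simp: add_left add_right sc_left sc_right)
qed

lemma wedge_ebasis:
  "ebasis S \<and>\<^sub>e ebasis T = (if S \<inter> T = {} then wedge_sign S T *\<^sub>R ebasis (S \<union> T) else 0)"
  by (simp add: wedge_def single_eq_scaleR[symmetric])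

lemma wedge_unit: "ebasis {} \<and>\<^sub>e x = x" "x \<and>\<^sub>e ebasis {} = x"
proof -
  have [simp]: "wedge_sign {} S = 1" "wedge_sign S {} = 1" for S by (simp_all add: wedge_sign_def)
  show "ebasis {} \<and>\<^sub>e x = x" "x \<and>\<^sub>e ebasis {} = x"
    by (simp_all add: wedge_def single_eq_scaleR[symmetric]
        ext_expansion[of x, unfolded single_eq_scaleR[symmetric], symmetric])
qed

lemma wedge_sign_Un_left:
  assumes "finite S" "finite T" "finite U" "S \<inter> T = {}"
  shows "wedge_sign (S \<union> T) U = wedge_sign S U * wedge_sign T U"
proof -
  have fin: "finite {(i, j). i \<in> S \<and> j \<in> U \<and> j < i}" "finite {(i, j). i \<in> T \<and> j \<in> U \<and> j < i}"
    using assms by (auto intro: finite_subset[of _ "S \<times> U"] finite_subset[of _ "T \<times> U"])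
  have "{(i, j). i \<in> S \<union> T \<and> j \<in> U \<and> j < i} =
      {(i, j). i \<in> S \<and> j \<in> U \<and> j < i} \<union> {(i, j). i \<in> T \<and> j \<in> U \<and> j < i}" by auto
  then show ?thesis
    unfolding wedge_sign_def power_add[symmetric]
    using assms(4) fin by (subst card_Un_disjoint[symmetric]) auto
qed

lemma wedge_sign_Un_right:
  assumes "finite S" "finite T" "finite U" "T \<inter> U = {}"
  shows "wedge_sign S (T \<union> U) = wedge_sign S T * wedge_sign S U"
proof -
  have fin: "finite {(i, j). i \<in> S \<and> j \<in> U \<and> j < i}" "finite {(i, j). i \<in> S \<and> j \<in> T \<and> j < i}"
    using assms by (auto intro: finite_subset[of _ "S \<times> U"] finite_subset[of _ "S \<times> T"])
  have "{(i, j). i \<in> S \<and> j \<in> T \<union> U \<and> j < i} =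
      {(i, j). i \<in> S \<and> j \<in> T \<and> j < i} \<union> {(i, j). i \<in> S \<and> j \<in> U \<and> j < i}" by auto
  then show ?thesis
    unfolding wedge_sign_def power_add[symmetric]
    using assms(4) fin by (subst card_Un_disjoint[symmetric]) auto
qed

lemma wedge_assoc:
  assumes fin: "\<And>S. S \<in> Poly_Mapping.keys x \<union> Poly_Mapping.keys y \<union> Poly_Mapping.keys z \<Longrightarrow> finite S"
  shows "(x \<and>\<^sub>e y) \<and>\<^sub>e z = x \<and>\<^sub>e (y \<and>\<^sub>e z)"
proof -
  note b = bilinear_wedge
  have mono: "(ebasis S \<and>\<^sub>e ebasis T) \<and>\<^sub>e ebasis U = ebasis S \<and>\<^sub>e (ebasis T \<and>\<^sub>e ebasis U)"
    if "finite S" "finite T" "finite U" for S T U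
    using that
    by (auto simp: wedge_ebasis bilinear_lmul[OF b] bilinear_rmul[OF b] bilinear_lzero[OF b]
        bilinear_rzero[OF b] wedge_sign_Un_left wedge_sign_Un_right Int_Un_distrib Int_Un_distrib2
        Un_assoc mult_ac)
  have lsum: "(sum f A) \<and>\<^sub>e u = (\<Sum>a\<in>A. f a \<and>\<^sub>e u)" for f :: "nat set \<Rightarrow> ext" and A u
    using linear_sum[of "\<lambda>v. v \<and>\<^sub>e u" f A] b by (simp add: bilinear_def)
  have rsum: "u \<and>\<^sub>e (sum f A) = (\<Sum>a\<in>A. u \<and>\<^sub>e f a)" for f :: "nat set \<Rightarrow> ext" and A u
    using linear_sum[of "\<lambda>v. u \<and>\<^sub>e v" f A] b by (simp add: bilinear_def)
  show ?thesis
    apply (subst (1 2) ext_expansion[of x], subst (1 2) ext_expansion[of y],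
        subst (1 2) ext_expansion[of z])
    apply (simp only: lsum rsum bilinear_lmul[OF b] bilinear_rmul[OF b])
    apply (intro sum.cong refl)
    using fin by (simp add: mono)
qed

lemma wedge_vector_self:
  assumes "v \<in> ext_vectors n"
  shows "v \<and>\<^sub>e v = 0"
proof -
  note b = bilinear_wedge
  note bs = bilinear_ladd[OF b] bilinear_radd[OF b] bilinear_lmul[OF b] bilinear_rmul[OF b]
    bilinear_lzero[OF b] bilinear_rzero[OF b]
  have sgn: "wedge_sign {i} {j} = (if j < i then -1 else 1)" for i j
  proof -
    have "{(a, c). a \<in> {i} \<and> c \<in> {j} \<and> c < a} = (if j < i then {(i, j)} else {})" by auto
    then show ?thesis by (simp add: wedge_sign_def)
  qed
  have anti: "ebasis {i} \<and>\<^sub>e ebasis {j} = - (ebasis {j} \<and>\<^sub>e ebasis {i})" for i j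
    by (auto simp: wedge_ebasis sgn insert_commute)
  have anti_v: "ebasis {i} \<and>\<^sub>e u = - (u \<and>\<^sub>e ebasis {i})" if "u \<in> ext_vectors n" for i u
    using that unfolding ext_vectors_def
  proof (induction rule: span_induct_alt)
    case (step a x y)
    then obtain j where "x = ebasis {j}" by auto
    then show ?case using step anti[of i j] by (simp add: bs)
  qed (simp add: bs)
  have "v \<in> ext_vectors n \<and> v \<and>\<^sub>e v = 0"
    using assms unfolding ext_vectors_def
  proof (induction rule: span_induct_alt)
    case base
    show ?case by (simp add: bs span_zero)
  next
    case (step a x y)
    then obtain i where i: "x = ebasis {i}" by auto
    have y: "x \<and>\<^sub>e y = - (y \<and>\<^sub>e x)"
      using anti_v[of y i] step i by (simp add: ext_vectors_def)
    have x: "x \<and>\<^sub>e x = 0" by (simp add: i wedge_ebasis)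
    have "(a *\<^sub>R x + y) \<and>\<^sub>e (a *\<^sub>R x + y) = 0"
      using step y x by (simp add: bs)
    then show ?case using step by (auto intro: span_add span_scale span_base)
  qed
  then show ?thesis ..
qed

lemma ebasis_eq_wedge:
  assumes "sorted_wrt (<) is"
  shows "foldr (\<and>\<^sub>e) (map (\<lambda>i. ebasis {i}) is) (ebasis {}) = ebasis (set is)"
  using assms
proof (induction "is")
  case (Cons i "is")
  then have none: "{(a, c). a \<in> {i} \<and> c \<in> set is \<and> c < a} = {}" by auto
  have "wedge_sign {i} (set is) = 1" unfolding wedge_sign_def none by simp
  then show ?case using Cons by (auto simp: wedge_ebasis)
qed simp

lemma ext_power_eq_span:
  "ext_power n r = span (ebasis ` {S. S \<subseteq> {..<n} \<and> card S = r})"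
proof (rule antisym)
  note b = bilinear_wedge
  note bs = bilinear_ladd[OF b] bilinear_radd[OF b] bilinear_lmul[OF b] bilinear_rmul[OF b]
    bilinear_lzero[OF b] bilinear_rzero[OF b]
  let ?B = "\<lambda>r. span (ebasis ` {S. S \<subseteq> {..<n} \<and> card S = r})"
  have mono: "ebasis {i} \<and>\<^sub>e y \<in> ?B (Suc r)" if "i < n" "y \<in> ?B r" for i y r
    using that(2)
  proof (induction rule: span_induct_alt)
    case (step a x y)
    then obtain S where S: "x = ebasis S" "S \<subseteq> {..<n}" "card S = r" by auto
    then have "finite S" using finite_subset by blast
    then have "ebasis {i} \<and>\<^sub>e x \<in> ?B (Suc r)"
      using S that(1)
      by (cases "i \<in> S")
        (auto simp: wedge_ebasis span_zero intro!: span_scale[OF span_base] imageI)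
    then show ?case using step by (simp add: bs span_add span_scale)
  qed (simp add: bs span_zero)
  have step: "v \<and>\<^sub>e y \<in> ?B (Suc r)" if "v \<in> ext_vectors n" "y \<in> ?B r" for v y r
    using that(1) unfolding ext_vectors_def
    by (induction rule: span_induct_alt) (auto simp: bs span_zero intro!: span_add span_scale mono that(2))
  have "foldr (\<and>\<^sub>e) vs (ebasis {}) \<in> ?B (length vs)" if "set vs \<subseteq> ext_vectors n" for vs
    using that
  proof (induction vs)
    case Nil
    show ?case by (auto intro!: span_base)
  next
    case (Cons v vs)
    then show ?case using step[of v _ "length vs"] by simp
  qed
  then show "ext_power n r \<subseteq> ?B r"
    unfolding ext_power_def by (intro span_minimal) auto
  have "ebasis S \<in> ext_power n r" if "S \<subseteq> {..<n}" "card S = r" for S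
  proof -
    have fin: "finite S" using that(1) finite_subset by blast
    have "foldr (\<and>\<^sub>e) (map (\<lambda>i. ebasis {i}) (sorted_list_of_set S)) (ebasis {}) = ebasis S"
      using fin by (simp add: ebasis_eq_wedge)
    moreover have "set (map (\<lambda>i. ebasis {i}) (sorted_list_of_set S)) \<subseteq> ext_vectors n"
      using fin that(1) by (auto simp: ext_vectors_def intro!: span_base)
    moreover have "length (map (\<lambda>i. ebasis {i}) (sorted_list_of_set S)) = r"
      using fin that(2) by simp
    ultimately show ?thesis
      unfolding ext_power_def by (intro span_base) (metis (mono_tags, lifting) mem_Collect_eq)
  qed
  then show "?B r \<subseteq> ext_power n r"
    by (intro span_minimal) (auto simp: ext_power_def)
qed

lemma independent_ebasis: "independent (range ebasis)"
proof -
  have inj: "inj ebasis" by (rule injI) (metis lookup_single_eq lookup_single_not_eq zero_neq_one)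
  show ?thesis
    unfolding independent_explicit_module
  proof (intro allI impI)
    fix F u x
    assume F: "finite F" "F \<subseteq> range ebasis" "(\<Sum>v\<in>F. u v *\<^sub>R v) = 0" "x \<in> F"
    then obtain S where S: "x = ebasis S" by auto
    have "Poly_Mapping.lookup (\<Sum>v\<in>F. u v *\<^sub>R v) S = (\<Sum>v\<in>F. if v = x then u v else 0)"
      unfolding lookup_sum
    proof (intro sum.cong refl)
      fix v assume "v \<in> F"
      then obtain T where "v = ebasis T" using F(2) by auto
      then show "Poly_Mapping.lookup (u v *\<^sub>R v) S = (if v = x then u v else 0)"
        using S inj by (auto simp: lookup_scaleR_ext lookup_single when_def dest: injD)
    qed
    then show "u x = 0" using F by simp
  qed
qed

lemma dim_ext_power: "dim (ext_power n r) = n choose r"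
proof -
  have "dim (ext_power n r) = card (ebasis ` {S. S \<subseteq> {..<n} \<and> card S = r})"
    unfolding ext_power_eq_span dim_span
    by (intro dim_eq_card_independent independent_mono[OF independent_ebasis]) auto
  also have "\<dots> = card {S. S \<subseteq> {..<n} \<and> card S = r}"
    by (intro card_image inj_onI) (metis lookup_single_eq lookup_single_not_eq zero_neq_one)
  finally show ?thesis using n_subsets[of "{..<n}" r] by simp
qed

text \<open>Multiplying by the zeroth power, that is by scalars, does not change a subspace.\<close>

lemma wedge_space_ext_power_0:
  assumes "subspace W"
  shows "wedge_space W (ext_power n 0) = W"
proof -
  have P0: "ext_power n 0 = span {ebasis {}}" by (simp add: ext_power_def)
  have "u \<and>\<^sub>e w \<in> W" if u: "u \<in> W" and w: "w \<in> ext_power n 0" for u w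
  proof -
    obtain a where "w = a *\<^sub>R ebasis {}" using w unfolding P0 span_singleton by auto
    then show ?thesis
      using u by (simp add: bilinear_rmul[OF bilinear_wedge] wedge_unit subspace_scale[OF assms])
  qed
  then have "wedge_space W (ext_power n 0) \<subseteq> W"
    unfolding wedge_space_def by (intro span_minimal assms) auto
  moreover have "u \<in> wedge_space W (ext_power n 0)" if "u \<in> W" for u
  proof -
    have "ebasis {} \<in> ext_power n 0" by (simp add: P0 span_base)
    with that have "u \<and>\<^sub>e ebasis {} \<in> wedge_space W (ext_power n 0)"
      unfolding wedge_space_def by (intro span_base) blast
    then show ?thesis by (simp add: wedge_unit)
  qed
  ultimately show ?thesis by blast
qed

end

theory Submission
  imports Defs "HOL-Library.Nat_Bijection"
begin

text \<open>
  The inequality is the local LYM inequality for set families, transported to the exterior algebra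
  by passing to leading terms.

  Order the basis elements \<open>e\<^sub>S\<close> by the binary value \<open>\<Sum>i\<in>S. 2 ^ i\<close> of the index set
  (\<^const>\<open>set_encode\<close>). This value is injective on finite sets and additive on disjoint unions, so
  that if \<open>w\<close> has leading index \<open>S\<close> and \<open>T\<close> is disjoint from \<open>S\<close>, then \<open>w \<and>\<^sub>e e\<^sub>T\<close> has leading index
  \<open>S \<union> T\<close>. By Gaussian elimination the dimension of a space of exterior forms is the number of leading
  indices of its nonzero elements (\<open>dim_le_card_leading_indices\<close>, \<open>card_leading_indices_le_dim\<close>).
  Hence if \<open>A\<close> is the family of leading indices of \<open>W\<close>, then \<open>card A = dim W\<close>, and the leading indices
  of the product of \<open>W\<close> with the \<open>c\<close>-th power include the upper shadow of \<open>A\<close>, the family of all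
  \<open>(r + c)\<close>-subsets of \<open>{..<n}\<close> that contain a member of \<open>A\<close>.

  Counting the pairs \<open>S \<subseteq> B\<close> with \<open>S \<in> A\<close> and \<open>B\<close> in the shadow shows that the shadow has at least
  the density of \<open>A\<close>. If the densities agree, then \<open>A\<close> contains every \<open>r\<close>-subset of every set
  in the shadow; for \<open>c \<ge> 1\<close> this makes \<open>A\<close> closed under exchanging one element, so \<open>A\<close> is empty or
  consists of all \<open>r\<close>-subsets (\<open>local_LYM\<close>, \<open>local_LYM_equality\<close>). Equality for
  \<open>W\<close> forces equality for \<open>A\<close>, since the density of the shadow lies between those of \<open>W\<close> and of the
  product; then \<open>dim W = card A\<close> is \<open>0\<close> or the full dimension.
\<close>

section \<open>The local LYM inequality\<close>

definition layer :: "nat \<Rightarrow> nat \<Rightarrow> nat set set" where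
  "layer n r = {S. S \<subseteq> {..<n} \<and> card S = r}"

definition upper_shadow :: "nat \<Rightarrow> nat \<Rightarrow> nat set set \<Rightarrow> nat set set" where
  "upper_shadow n k A = {B \<in> layer n k. \<exists>S\<in>A. S \<subseteq> B}"

lemma finite_layer: "finite (layer n r)"
  by (rule finite_subset[of _ "Pow {..<n}"]) (auto simp: layer_def)

lemma finite_upper_shadow: "finite (upper_shadow n k A)"
  unfolding upper_shadow_def using finite_layer by simp

lemma card_layer: "card (layer n r) = n choose r"
  using n_subsets[of "{..<n}" r] by (simp add: layer_def)

lemma layerD:
  assumes "S \<in> layer n r"
  shows "S \<subseteq> {..<n}" "card S = r" "finite S"
  using assms finite_subset[of S "{..<n}"] by (auto simp: layer_def)

lemma card_layer_supersets:
  assumes "S \<in> layer n r"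
  shows "card {B \<in> layer n (r + c). S \<subseteq> B} = (n - r) choose c"
proof -
  have S: "S \<subseteq> {..<n}" "card S = r" "finite S"
    using layerD[OF assms] by auto
  let ?T = "{T. T \<subseteq> {..<n} - S \<and> card T = c}"
  have card_Un: "card (S \<union> T) = r + c" if "T \<in> ?T" for T
    using that S by (subst card_Un_disjoint) (auto intro: finite_subset[of T "{..<n}"])
  have "bij_betw (\<lambda>T. S \<union> T) ?T {B \<in> layer n (r + c). S \<subseteq> B}"
    by (rule bij_betw_byWitness[where f' = "\<lambda>B. B - S"])
      (use S card_Un in \<open>auto simp: layer_def card_Diff_subset\<close>)
  then have "card {B \<in> layer n (r + c). S \<subseteq> B} = card ?T"
    by (simp add: bij_betw_same_card)
  also have "\<dots> = (n - r) choose c"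
    using n_subsets[of "{..<n} - S" c] S by (simp add: card_Diff_subset)
  finally show ?thesis .
qed

text \<open>Both sides count the inclusions between members of \<open>A\<close> and members of its shadow.\<close>

lemma shadow_double_count:
  assumes "A \<subseteq> layer n r"
  shows "(\<Sum>B\<in>upper_shadow n (r + c) A. card {S \<in> A. S \<subseteq> B}) = card A * ((n - r) choose c)"
proof -
  let ?U = "upper_shadow n (r + c) A"
  have "{B \<in> ?U. S \<subseteq> B} = {B \<in> layer n (r + c). S \<subseteq> B}" if "S \<in> A" for S
    using that by (auto simp: upper_shadow_def)
  then have "\<forall>S\<in>A. card {B \<in> ?U. S \<subseteq> B} = (n - r) choose c"
    using card_layer_supersets assms by auto
  then have "(\<Sum>B\<in>?U. card {S \<in> A. S \<subseteq> B}) = (\<Sum>S\<in>A. (n - r) choose c)"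
    by (intro sum_multicount_gen finite_upper_shadow finite_subset[OF assms finite_layer])
  then show ?thesis by simp
qed

lemma card_family_below_le:
  assumes "A \<subseteq> layer n r" "B \<in> upper_shadow n (r + c) A"
  shows "card {S \<in> A. S \<subseteq> B} \<le> (r + c) choose r"
    and "card {S \<in> A. S \<subseteq> B} = (r + c) choose r \<Longrightarrow> S \<subseteq> B \<Longrightarrow> card S = r \<Longrightarrow> S \<in> A"
proof -
  have B: "finite B" "card B = r + c"
    using assms(2) layerD[of B n "r + c"] by (auto simp: upper_shadow_def)
  have fin: "finite {S. S \<subseteq> B \<and> card S = r}"
    using B by (auto intro: rev_finite_subset[of "Pow B"])
  have sub: "{S \<in> A. S \<subseteq> B} \<subseteq> {S. S \<subseteq> B \<and> card S = r}"
    using assms(1) by (auto simp: layer_def)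
  have eq: "card {S. S \<subseteq> B \<and> card S = r} = (r + c) choose r"
    using n_subsets[OF B(1), of r] B(2) by simp
  show "card {S \<in> A. S \<subseteq> B} \<le> (r + c) choose r"
    using card_mono[OF fin sub] eq by simp
  show "S \<in> A" if "card {S \<in> A. S \<subseteq> B} = (r + c) choose r" "S \<subseteq> B" "card S = r"
    using card_subset_eq[OF fin sub] eq that by auto
qed

text \<open>The common denominator is the number of chains \<open>S \<subseteq> B\<close> between the two full layers, counted
  from either end; over it, densities become the counts of \<open>shadow_double_count\<close>.\<close>

lemma densities_common_denominator:
  fixes a u :: nat
  assumes "r + c \<le> n"
  defines "K \<equiv> real ((n choose r) * ((n - r) choose c))"
  shows "real a / real (n choose r) = real (a * ((n - r) choose c)) / K"
    and "real u / real (n choose (r + c)) = real (u * ((r + c) choose r)) / K"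
    and "K > 0"
proof -
  have pos: "0 < n choose r" "0 < (r + c) choose r" "0 < (n - r) choose c"
    using assms by simp_all
  have K: "K = real ((n choose (r + c)) * ((r + c) choose r))"
    using choose_mult[of r "r + c" n] assms by simp
  show "real a / real (n choose r) = real (a * ((n - r) choose c)) / K"
    using pos by (simp add: K_def)
  show "real u / real (n choose (r + c)) = real (u * ((r + c) choose r)) / K"
    using pos by (simp add: K)
  show "K > 0" using pos by (simp add: K_def)
qed

theorem local_LYM:
  assumes "A \<subseteq> layer n r" "r + c \<le> n"
  shows "real (card A) / real (n choose r)
           \<le> real (card (upper_shadow n (r + c) A)) / real (n choose (r + c))"
proof -
  have "card A * ((n - r) choose c) \<le> card (upper_shadow n (r + c) A) * ((r + c) choose r)"
    unfolding shadow_double_count[OF assms(1), symmetric]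
    using sum_bounded_above[of "upper_shadow n (r + c) A" "\<lambda>B. card {S \<in> A. S \<subseteq> B}"]
      card_family_below_le(1)[OF assms(1)] by simp
  then show ?thesis
    unfolding densities_common_denominator(1)[OF assms(2), of "card A"]
      densities_common_denominator(2)[OF assms(2), of "card (upper_shadow n (r + c) A)"]
    by (intro divide_right_mono of_nat_mono order_less_imp_le[OF densities_common_denominator(3)[OF assms(2)]])
qed

text \<open>Any two sets of the layer are joined by a chain of single exchanges: each exchange brings the
  set one element closer to the target.\<close>

lemma exchange_closed_eq_layer:
  assumes A: "A \<subseteq> layer n r" "A \<noteq> {}"
    and exchange: "\<And>S x y. S \<in> A \<Longrightarrow> x < n \<Longrightarrow> x \<notin> S \<Longrightarrow> y \<in> S \<Longrightarrow> insert x (S - {y}) \<in> A"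
  shows "A = layer n r"
proof -
  have reach: "S' \<in> A" if "S \<in> A" "S' \<in> layer n r" for S S'
    using that
  proof (induction "card (S' - S)" arbitrary: S)
    case 0
    then have fin: "finite S" "finite S'" and card: "card S = card S'"
      using layerD[of S n r] layerD[of S' n r] A(1) "0.prems" by auto
    then have "S' \<subseteq> S" using 0 by simp
    then have "S' = S" using fin card card_subset_eq by metis
    then show ?case using 0 by simp
  next
    case (Suc k)
    then have fin: "finite S" "finite S'" and card: "card S = card S'" and S': "S' \<subseteq> {..<n}"
      using layerD[of S n r] layerD[of S' n r] A(1) Suc.prems by auto
    obtain x where x: "x \<in> S'" "x \<notin> S"
      using Suc.hyps(2) by (metis Diff_iff card_eq_0_iff all_not_in_conv nat.distinct(1))
    have "\<not> S \<subseteq> S'"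
      using x fin card card_subset_eq by metis
    then obtain y where y: "y \<in> S" "y \<notin> S'" by auto
    have "S' - insert x (S - {y}) = (S' - S) - {x}" using y by auto
    then have "card (S' - insert x (S - {y})) = k"
      using Suc.hyps(2) x fin by simp
    moreover have "insert x (S - {y}) \<in> A"
      using exchange Suc.prems x y S' by auto
    ultimately show ?case using Suc by blast
  qed
  then show ?thesis using A by blast
qed

theorem local_LYM_equality:
  assumes A: "A \<subseteq> layer n r" and "r + c \<le> n" "c \<ge> 1"
    and eq: "real (card A) / real (n choose r)
        = real (card (upper_shadow n (r + c) A)) / real (n choose (r + c))"
  shows "A = {} \<or> A = layer n r"
proof (cases "A = {}")
  case False
  let ?U = "upper_shadow n (r + c) A"
  have "real (card A * ((n - r) choose c)) = real (card ?U * ((r + c) choose r))"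
    using eq less_imp_neq[OF densities_common_denominator(3)[OF assms(2)]]
    unfolding densities_common_denominator(1)[OF assms(2), of "card A"]
      densities_common_denominator(2)[OF assms(2), of "card ?U"]
    by (metis divide_cancel_right)
  then have "(\<Sum>B\<in>?U. card {S \<in> A. S \<subseteq> B}) = (\<Sum>B\<in>?U. (r + c) choose r)"
    unfolding shadow_double_count[OF A] of_nat_eq_iff by simp
  then have sat: "card {S \<in> A. S \<subseteq> B} = (r + c) choose r" if "B \<in> ?U" for B
    using sum_mono_inv[OF _ _ that finite_upper_shadow] card_family_below_le(1)[OF A] by blast
  have "insert x (S - {y}) \<in> A" if S: "S \<in> A" "x < n" "x \<notin> S" "y \<in> S" for S x y
  proof -
    have S': "S \<subseteq> {..<n}" "card S = r" "finite S"
      using S layerD[of S n r] A by auto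
    \<comment> \<open>As \<open>c \<ge> 1\<close>, there is room in a member of the shadow for both \<open>S\<close> and \<open>x\<close>.\<close>
    have "card (insert x S) \<le> r + c" "insert x S \<subseteq> {..<n}"
      using S S' assms(3) by auto
    then obtain B where B: "insert x S \<subseteq> B" "B \<subseteq> {..<n}" "card B = r + c"
      using exists_subset_between[of "insert x S" "r + c" "{..<n}"] assms(2) by auto
    then have BU: "B \<in> ?U" using S by (auto simp: upper_shadow_def layer_def)
    have "card (insert x (S - {y})) = r"
      using S S' by (metis Diff_iff card.insert card_Suc_Diff1 finite_Diff)
    moreover have "insert x (S - {y}) \<subseteq> B" using B(1) by auto
    ultimately show ?thesis
      using card_family_below_le(2)[OF A BU sat[OF BU]] by simp
  qed
  then have "A = layer n r" by (rule exchange_closed_eq_layer[OF A False])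
  then show ?thesis ..
qed simp

section \<open>Leading indices\<close>

lemma set_encode_Un_disjoint:
  "finite S \<Longrightarrow> finite T \<Longrightarrow> S \<inter> T = {} \<Longrightarrow> set_encode (S \<union> T) = set_encode S + set_encode T"
  by (simp add: set_encode_def sum.union_disjoint)

definition leading_index :: "ext \<Rightarrow> nat set \<Rightarrow> bool" where
  "leading_index w S \<longleftrightarrow> S \<in> Poly_Mapping.keys w
     \<and> (\<forall>T\<in>Poly_Mapping.keys w. set_encode T \<le> set_encode S)"

definition leading_indices :: "ext set \<Rightarrow> nat set set" where
  "leading_indices W = {S. \<exists>w\<in>W. leading_index w S}"

lemma leading_index_exists:
  assumes "w \<noteq> 0"
  shows "\<exists>S. leading_index w S"
proof -
  have "Poly_Mapping.keys w \<noteq> {}" using assms by simp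
  then show ?thesis
    using Max_in[of "set_encode ` Poly_Mapping.keys w"] Max_ge[of "set_encode ` Poly_Mapping.keys w"]
    unfolding leading_index_def by (smt (verit) finite_imageI finite_keys image_iff image_is_empty)
qed

lemma ext_power_iff_keys: "x \<in> ext_power n r \<longleftrightarrow> Poly_Mapping.keys x \<subseteq> layer n r"
proof
  show "Poly_Mapping.keys x \<subseteq> layer n r" if "x \<in> ext_power n r"
    using that unfolding ext_power_eq_span layer_def[symmetric]
  proof (induction rule: span_induct_alt)
    case (step a x y)
    have "Poly_Mapping.keys (a *\<^sub>R x + y) \<subseteq> Poly_Mapping.keys x \<union> Poly_Mapping.keys y"
      by (auto simp: in_keys_iff lookup_add lookup_scaleR_ext)
    then show ?case using step by auto
  qed simp
  show "x \<in> ext_power n r" if "Poly_Mapping.keys x \<subseteq> layer n r"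
  proof -
    have "(\<Sum>S\<in>Poly_Mapping.keys x. Poly_Mapping.lookup x S *\<^sub>R ebasis S) \<in> ext_power n r"
      unfolding ext_power_eq_span layer_def[symmetric]
      using that by (intro span_sum span_scale span_base) auto
    then show ?thesis by (simp only: ext_expansion[symmetric])
  qed
qed

lemma leading_indices_subset_layer:
  "W \<subseteq> ext_power n r \<Longrightarrow> leading_indices W \<subseteq> layer n r"
  unfolding leading_indices_def leading_index_def using ext_power_iff_keys by blast

text \<open>Elimination: subtracting from \<open>w\<close> a multiple of a chosen element with the same leading index
  lowers the leading index, so the chosen elements span.\<close>

lemma dim_le_card_leading_indices:
  assumes W: "subspace W" "W \<subseteq> ext_power n r"
  shows "dim W \<le> card (leading_indices W)"
proof -
  let ?L = "leading_indices W"
  have "\<forall>S\<in>?L. \<exists>w. w \<in> W \<and> leading_index w S" by (auto simp: leading_indices_def)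
  then obtain f where f: "\<And>S. S \<in> ?L \<Longrightarrow> f S \<in> W \<and> leading_index (f S) S" by metis
  have span: "w \<in> span (f ` ?L)"
    if "w \<in> W" "\<forall>S\<in>Poly_Mapping.keys w. set_encode S < k" for w k
    using that
  proof (induction k arbitrary: w)
    case 0
    then have "w = 0" by (metis all_not_in_conv keys_eq_empty not_less_zero)
    then show ?case by (simp add: span_zero)
  next
    case (Suc k)
    show ?case
    proof (cases "w = 0")
      case False
      then obtain S where S: "leading_index w S" using leading_index_exists by blast
      then have "S \<in> ?L" using Suc.prems by (auto simp: leading_indices_def)
      then have fS: "f S \<in> W" "leading_index (f S) S" using f by auto
      define a where "a = Poly_Mapping.lookup w S / Poly_Mapping.lookup (f S) S"
      define v where "v = w - a *\<^sub>R f S"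
      have vW: "v \<in> W" unfolding v_def using W(1) Suc.prems(1) fS(1)
        by (simp add: subspace_diff subspace_scale)
      have "set_encode T < k" if T: "T \<in> Poly_Mapping.keys v" for T
      proof -
        have "Poly_Mapping.lookup v S = 0"
          using fS(2) by (simp add: v_def a_def lookup_minus lookup_scaleR_ext leading_index_def in_keys_iff)
        then have "T \<noteq> S" using T by (auto simp: in_keys_iff)
        have "T \<in> Poly_Mapping.keys w \<or> T \<in> Poly_Mapping.keys (f S)"
          using T by (auto simp: v_def lookup_minus lookup_scaleR_ext in_keys_iff)
        then have "set_encode T \<le> set_encode S"
          using S fS by (auto simp: leading_index_def)
        moreover have "finite T" "finite S"
          using T S vW W(2) Suc.prems(1) ext_power_iff_keys layerD(3)
          unfolding leading_index_def by blast+
        then have "set_encode T \<noteq> set_encode S" using \<open>T \<noteq> S\<close> set_encode_eq by blast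
        moreover have "set_encode S < Suc k" using Suc.prems S by (auto simp: leading_index_def)
        ultimately show ?thesis by simp
      qed
      then have "v \<in> span (f ` ?L)" using Suc.IH vW by blast
      then have "v + a *\<^sub>R f S \<in> span (f ` ?L)"
        using \<open>S \<in> ?L\<close> by (auto intro!: span_add span_scale intro: span_base)
      then show ?thesis by (simp add: v_def)
    qed (simp add: span_zero)
  qed
  have "W \<subseteq> span (f ` ?L)"
  proof
    fix w assume "w \<in> W"
    moreover have "\<forall>S\<in>Poly_Mapping.keys w. set_encode S < Suc (Max (set_encode ` Poly_Mapping.keys w))"
      by (auto simp: less_Suc_eq_le intro: Max_ge)
    ultimately show "w \<in> span (f ` ?L)" using span by blast
  qed
  moreover have fin: "finite ?L"
    using leading_indices_subset_layer[OF W(2)] finite_layer finite_subset by blast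
  ultimately have "dim W \<le> card (f ` ?L)" by (intro dim_le_card) auto
  then show ?thesis using card_image_le[OF fin, of f] by linarith
qed

text \<open>Elements with distinct leading indices form an echelon system: none of them lies in the span of
  those with smaller leading indices, all of which have coefficient zero at its leading index.\<close>

lemma independent_leading_indices:
  assumes "finite L" "\<And>S. S \<in> L \<Longrightarrow> finite S" "\<And>S. S \<in> L \<Longrightarrow> leading_index (f S) S"
  shows "independent (f ` L) \<and> card (f ` L) = card L"
  using assms
proof (induction L rule: finite_ranking_induct[where f = set_encode])
  case empty
  show ?case by (simp add: independent_empty)
next
  case (insert S L)
  have zero: "Poly_Mapping.lookup v S = 0" if "v \<in> span (f ` (L - {S}))" for v
    using that
  proof (induction rule: span_induct_alt)
    case (step a x y)
    then obtain T where T: "T \<in> L" "T \<noteq> S" "x = f T" by auto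
    have "set_encode T \<noteq> set_encode S"
      using T insert.prems(1) set_encode_eq by blast
    then have "set_encode T < set_encode S"
      using insert.hyps T by (simp add: le_neq_implies_less)
    then have "S \<notin> Poly_Mapping.keys x"
      using T insert.prems(2)[of T] by (auto simp: leading_index_def)
    then show ?case using step by (simp add: lookup_add lookup_scaleR_ext in_keys_iff)
  qed simp
  show ?case
  proof (cases "S \<in> L")
    case True
    then show ?thesis using insert by (simp add: insert_absorb)
  next
    case False
    have "Poly_Mapping.lookup (f S) S \<noteq> 0"
      using insert.prems(2)[of S] by (simp add: leading_index_def in_keys_iff)
    then have "f S \<notin> span (f ` L)" using zero[of "f S"] False by auto
    moreover from this have "f S \<notin> f ` L" by (metis span_base)
    ultimately show ?thesis
      using insert.IH insert.prems insert.hyps(1) False by (simp add: independent_insert)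
  qed
qed

lemma card_leading_indices_le_dim:
  assumes W: "W \<subseteq> ext_power n r"
  shows "card (leading_indices W) \<le> dim W"
proof -
  let ?L = "leading_indices W"
  have L: "?L \<subseteq> layer n r" using leading_indices_subset_layer[OF W] .
  have "\<forall>S\<in>?L. \<exists>w. w \<in> W \<and> leading_index w S" by (auto simp: leading_indices_def)
  then obtain f where f: "\<And>S. S \<in> ?L \<Longrightarrow> f S \<in> W \<and> leading_index (f S) S" by metis
  have ind: "independent (f ` ?L)" and card: "card (f ` ?L) = card ?L"
    using independent_leading_indices[of ?L f] f L layerD(3) finite_subset[OF L finite_layer]
    by blast+
  obtain B where B: "B \<subseteq> W" "independent B" "W \<subseteq> span B" "card B = dim W"
    using basis_exists by blast
  have "finite B"
    using independent_span_bound[OF _ B(2), of "ebasis ` layer n r"] B(1) W finite_layer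
    unfolding ext_power_eq_span layer_def[symmetric] by blast
  then have "card (f ` ?L) \<le> card B"
    using independent_span_bound[OF _ ind, of B] B(3) f by blast
  then show ?thesis using card B(4) by simp
qed

text \<open>The ambient type is infinite-dimensional, so the finite bound on independent sets comes from
  the basis of the exterior power.\<close>

lemma full_dim_ext_power:
  assumes W: "subspace W" "W \<subseteq> ext_power n r" and dim: "dim (ext_power n r) \<le> dim W"
  shows "ext_power n r \<subseteq> W"
proof
  fix x assume x: "x \<in> ext_power n r"
  obtain B where B: "B \<subseteq> W" "independent B" "W \<subseteq> span B" "card B = dim W"
    using basis_exists by blast
  have bound: "finite C \<and> card C \<le> n choose r" if C: "independent C" "C \<subseteq> ext_power n r" for C
  proof -
    have "finite C \<and> card C \<le> card (ebasis ` layer n r)"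
      using C independent_span_bound[of "ebasis ` layer n r" C] finite_layer
      by (simp add: ext_power_eq_span layer_def[symmetric])
    then show ?thesis
      using card_image_le[OF finite_layer, of ebasis n r] by (simp add: card_layer)
  qed
  have "x \<in> span B"
  proof (rule ccontr)
    assume "x \<notin> span B"
    moreover from this have "x \<notin> B" using span_base by blast
    ultimately have "independent (insert x B)" using B(2) by (simp add: independent_insert)
    then have "card (insert x B) \<le> n choose r" using bound x B(1) W(2) by blast
    moreover have "finite B" using bound B(1,2) W(2) by blast
    ultimately show False using \<open>x \<notin> B\<close> B(4) dim by (simp add: dim_ext_power)
  qed
  then show "x \<in> W" using span_minimal[OF B(1) W(1)] by blast
qed

section \<open>Leading indices of products\<close>

lemma wedge_in_ext_power:
  assumes "x \<in> ext_power n r" "y \<in> ext_power n c"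
  shows "x \<and>\<^sub>e y \<in> ext_power n (r + c)"
  unfolding wedge_superset[OF finite_keys order_refl finite_keys order_refl]
    ext_power_eq_span layer_def[symmetric]
proof (intro span_sum)
  fix S T assume "S \<in> Poly_Mapping.keys x" "T \<in> Poly_Mapping.keys y"
  then have S: "S \<in> layer n r" and T: "T \<in> layer n c"
    using assms ext_power_iff_keys by auto
  then have "S \<union> T \<in> layer n (r + c)" if "S \<inter> T = {}"
    using that layerD(3)[OF S] layerD(3)[OF T]
    by (auto simp: layer_def card_Un_disjoint)
  then show "(if S \<inter> T = {} then
      (wedge_sign S T * Poly_Mapping.lookup x S * Poly_Mapping.lookup y T) *\<^sub>R ebasis (S \<union> T) else 0)
      \<in> span (ebasis ` layer n (r + c))"
    by (auto simp: span_zero intro!: span_scale intro: span_base)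
qed

lemma wedge_space_subset_ext_power:
  assumes "W \<subseteq> ext_power n r"
  shows "wedge_space W (ext_power n c) \<subseteq> ext_power n (r + c)"
proof -
  have "subspace (ext_power n (r + c))" by (simp add: ext_power_def)
  then show ?thesis
    unfolding wedge_space_def using wedge_in_ext_power assms by (intro span_minimal) auto
qed

lemma lookup_wedge_ebasis:
  "Poly_Mapping.lookup (w \<and>\<^sub>e ebasis T) U =
     (if T \<subseteq> U then wedge_sign (U - T) T * Poly_Mapping.lookup w (U - T) else 0)"
proof -
  have "w \<and>\<^sub>e ebasis T = (\<Sum>S\<in>Poly_Mapping.keys w. if S \<inter> T = {} then
      (wedge_sign S T * Poly_Mapping.lookup w S) *\<^sub>R ebasis (S \<union> T) else 0)"
    by (subst wedge_superset[of "Poly_Mapping.keys w" _ "{T}"]) (simp_all cong: if_cong)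
  then have "Poly_Mapping.lookup (w \<and>\<^sub>e ebasis T) U = (\<Sum>S\<in>Poly_Mapping.keys w.
      if S \<inter> T = {} \<and> S \<union> T = U then wedge_sign S T * Poly_Mapping.lookup w S else 0)"
    by (auto simp: lookup_sum lookup_scaleR_ext lookup_single when_def intro!: sum.cong)
  also have "\<dots> = (\<Sum>S\<in>Poly_Mapping.keys w.
      if S = U - T then (if T \<subseteq> U then wedge_sign S T * Poly_Mapping.lookup w S else 0) else 0)"
    by (intro sum.cong refl) auto
  also have "\<dots> = (if T \<subseteq> U then wedge_sign (U - T) T * Poly_Mapping.lookup w (U - T) else 0)"
    by (simp add: in_keys_iff)
  finally show ?thesis .
qed

text \<open>Every index of the product is \<open>R \<union> T\<close> for an index \<open>R\<close> of \<open>w\<close> disjoint from \<open>T\<close>, and adjoining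
  \<open>T\<close> shifts the binary values of all such \<open>R\<close> by the same amount.\<close>

lemma leading_index_wedge_ebasis:
  assumes w: "leading_index w S" and fin: "\<And>R. R \<in> Poly_Mapping.keys w \<Longrightarrow> finite R"
    and T: "finite T" "S \<inter> T = {}"
  shows "leading_index (w \<and>\<^sub>e ebasis T) (S \<union> T)"
  unfolding leading_index_def
proof (intro conjI ballI)
  have "(S \<union> T) - T = S" using T by auto
  moreover have "wedge_sign S T \<noteq> 0" by (simp add: wedge_sign_def)
  ultimately show "S \<union> T \<in> Poly_Mapping.keys (w \<and>\<^sub>e ebasis T)"
    using w by (simp add: in_keys_iff lookup_wedge_ebasis leading_index_def)
next
  fix U assume "U \<in> Poly_Mapping.keys (w \<and>\<^sub>e ebasis T)"
  then have U: "T \<subseteq> U" "U - T \<in> Poly_Mapping.keys w"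
    by (auto simp: in_keys_iff lookup_wedge_ebasis split: if_splits)
  have "set_encode U = set_encode (U - T) + set_encode T"
    using set_encode_Un_disjoint[OF fin[OF U(2)] T(1)] U(1) by (simp add: Int_commute Un_absorb2)
  also have "\<dots> \<le> set_encode S + set_encode T"
    using w U(2) by (simp add: leading_index_def)
  also have "\<dots> = set_encode (S \<union> T)"
    using set_encode_Un_disjoint[of S T] fin[of S] T w by (simp add: leading_index_def)
  finally show "set_encode U \<le> set_encode (S \<union> T)" .
qed

lemma upper_shadow_leading_indices:
  assumes W: "W \<subseteq> ext_power n r"
  shows "upper_shadow n (r + c) (leading_indices W)
           \<subseteq> leading_indices (wedge_space W (ext_power n c))"
proof
  fix B assume "B \<in> upper_shadow n (r + c) (leading_indices W)"
  then obtain S w where B: "B \<subseteq> {..<n}" "card B = r + c" and S: "S \<subseteq> B"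
    and w: "w \<in> W" "leading_index w S"
    by (auto simp: upper_shadow_def layer_def leading_indices_def)
  have keys: "Poly_Mapping.keys w \<subseteq> layer n r" using w(1) W ext_power_iff_keys by blast
  then have S': "S \<in> layer n r" using w(2) by (auto simp: leading_index_def)
  have "finite B" using B(1) finite_subset by blast
  then have T: "B - S \<in> layer n c"
    using B S S' layerD(3)[OF S'] by (auto simp: layer_def card_Diff_subset)
  have "leading_index (w \<and>\<^sub>e ebasis (B - S)) (S \<union> (B - S))"
    using w(2) keys layerD(3) T by (intro leading_index_wedge_ebasis) blast+
  moreover have "S \<union> (B - S) = B" using S by auto
  moreover have "ebasis (B - S) \<in> ext_power n c"
    using T by (simp add: ext_power_iff_keys)
  then have "w \<and>\<^sub>e ebasis (B - S) \<in> wedge_space W (ext_power n c)"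
    unfolding wedge_space_def using w(1) by (intro span_base) blast
  ultimately show "B \<in> leading_indices (wedge_space W (ext_power n c))"
    unfolding leading_indices_def by auto
qed

section \<open>Density of a product with an exterior power\<close>

theorem theorem2p7:
  fixes n r c :: nat and W :: "ext set"
  assumes "r \<le> n" and "c \<le> n - r"
    and "subspace W" and "W \<subseteq> ext_power n r"
  shows "real (dim (wedge_space W (ext_power n c))) / real (n choose (r + c))
           \<ge> real (dim W) / real (n choose r)
       \<and> (c \<ge> 1 \<longrightarrow>
           real (dim (wedge_space W (ext_power n c))) / real (n choose (r + c))
             = real (dim W) / real (n choose r)
           \<longrightarrow> W = {0} \<or> W = ext_power n r)"
proof -
  let ?P = "wedge_space W (ext_power n c)" and ?A = "leading_indices W"
  let ?U = "upper_shadow n (r + c) ?A"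
  have rc: "r + c \<le> n" using assms by simp
  have A: "?A \<subseteq> layer n r" using leading_indices_subset_layer[OF assms(4)] .
  have P: "?P \<subseteq> ext_power n (r + c)" using wedge_space_subset_ext_power[OF assms(4)] .
  have dim_W: "dim W = card ?A"
    using dim_le_card_leading_indices[OF assms(3,4)] card_leading_indices_le_dim[OF assms(4)] by simp
  have "card ?U \<le> card (leading_indices ?P)"
    by (intro card_mono finite_subset[OF leading_indices_subset_layer[OF P] finite_layer]
        upper_shadow_leading_indices[OF assms(4)])
  also have "\<dots> \<le> dim ?P" using card_leading_indices_le_dim[OF P] .
  finally have dim_P: "real (card ?U) / real (n choose (r + c)) \<le> real (dim ?P) / real (n choose (r + c))"
    by (simp add: divide_right_mono)
  have LYM: "real (dim W) / real (n choose r) \<le> real (card ?U) / real (n choose (r + c))"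
    unfolding dim_W using local_LYM[OF A rc] .
  have "W = {0} \<or> W = ext_power n r"
    if "c \<ge> 1" and eq: "real (dim ?P) / real (n choose (r + c)) = real (dim W) / real (n choose r)"
  proof -
    have "real (card ?A) / real (n choose r) = real (card ?U) / real (n choose (r + c))"
      using LYM dim_P eq dim_W by simp
    then consider "?A = {}" | "?A = layer n r"
      using local_LYM_equality[OF A rc \<open>c \<ge> 1\<close>] by blast
    then show ?thesis
    proof cases
      case 1
      then have "w = 0" if "w \<in> W" for w
        using that leading_index_exists[of w] unfolding leading_indices_def by blast
      then show ?thesis using subspace_0[OF assms(3)] by blast
    next
      case 2
      then have "dim (ext_power n r) \<le> dim W"
        using dim_W by (simp add: card_layer dim_ext_power)
      then have "ext_power n r \<subseteq> W" using full_dim_ext_power assms(3,4) by blast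
      then show ?thesis using assms(4) by blast
    qed
  qed
  then show ?thesis using LYM dim_P by auto
qed

end
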